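(* Let $r>0$, $s\in\mathbb N$, $a>0$. For any $q\in[2,\infty)$ such that $\lambda:=a-2/q>0$ and any $\varepsilon\in(0,1]$, $$n_\varepsilon\;\le\;q\,\lambda^{-qs}\,\varepsilon^{-(1+q)/r},$$ where $n_\varepsilon:=n_\varepsilon(U^{r,a}(\mathbb T^s),L_2(\mathbb T^s))$.
   Context: $\mathbb N=\{1,2,\dots\}$. $\mathbb T^s=[-\pi,\pi]^s$ is the $s$-dimensional torus, and $L_2(\mathbb T^s)$ carries the inner product $(f,g)=(2\pi)^{-s}\int_{\mathbb T^s}f(\mathbf x)\overline{g(\mathbf x)}\,d\mathbf x$ and norm $\|f\|=(f,f)^{1/2}$. For $\mathbf k\in\mathbb Z^s$, $e_{\mathbf k}(\mathbf x)=e^{i(\mathbf k,\mathbf x)}$, $\hat f(\mathbf k)=(f,e_{\mathbf k})$. For $a>0$ put $\lambda_a(\mathbf k):=\prod_{j=1}^s(a+|k_j|)$. The modified Korobov space $K^{r,a}(\mathbb T^s)$ is the Hilbert space of all $f=\kappa_{r,a}*g$ with $g\in L_2(\mathbb T^s)$, where $\kappa_{r,a}=\sum_{\mathbf k\in\mathbb Z^s}\lambda_a(\mathbf k)^{-r}e_{\mathbf k}$ (in the distributional sense), i.e. $\hat f(\mathbf k)=\lambda_a(\mathbf k)^{-r}\hat g(\mathbf k)$, with norm $\|f\|_{K^{r,a}(\mathbb T^s)}:=\|g\|$; equivalently $\|f\|^2_{K^{r,a}(\mathbb T^s)}=\sum_{\mathbf k\in\mathbb Z^s}\lambda_a(\mathbf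 k)^{2r}|\hat f(\mathbf k)|^2$. $U^{r,a}(\mathbb T^s)$ is the (closed) unit ball of $K^{r,a}(\mathbb T^s)$. For a normed space $X$ and a centrally symmetric $W\subset X$, the Kolmogorov $n$-width is $d_n(W,X):=\inf_{L_n}\sup_{f\in W}\inf_{g\in L_n}\|f-g\|_X$ (outer infimum over linear subspaces of $X$ of dimension $\le n$), and the $\varepsilon$-dimension $n_\varepsilon(W,X)$ is its inverse: the smallest $n\in\mathbb N_0=\{0,1,2,\dots\}$ such that some linear subspace $L\subset X$ of dimension $\le n$ satisfies $\sup_{f\in W}\inf_{g\in L}\|f-g\|_X\le\varepsilon$. *)

theory Defs
  imports "HOL-Analysis.Analysis" "HOL-Library.Function_Algebras"
begin

section \<open>The epsilon-dimension of a set in a complex normed space\<close>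

text \<open>The space is given by its carrier \<open>X\<close>, its scalar multiplication and its norm. The carrier
  may also consist of representatives modulo the null space of a seminorm: distances do not see
  the choice of representatives, and the subspaces of dimension at most \<open>n\<close> of the quotient are
  exactly the images of the spans of at most \<open>n\<close> representatives.\<close>

definition subspaces_dim_le ::
    "(complex \<Rightarrow> 'v \<Rightarrow> 'v) \<Rightarrow> 'v::ab_group_add set \<Rightarrow> nat \<Rightarrow> 'v set set" where
  "subspaces_dim_le scl X n =
     {L. L \<subseteq> X \<and> (\<exists>B. finite B \<and> card B \<le> n \<and> L = module.span scl B)}"

text \<open>The value is \<open>\<infinity>\<close> if no finite-dimensional subspace is good enough.\<close>

definition eps_dimension ::
    "(complex \<Rightarrow> 'v \<Rightarrow> 'v) \<Rightarrow> 'v::ab_group_add set \<Rightarrow> ('v \<Rightarrow> real) \<Rightarrow> real \<Rightarrow> 'v set \<Rightarrow> enat" where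
  "eps_dimension scl X nrm \<epsilon> W =
     (INF n \<in> {n. \<exists>L \<in> subspaces_dim_le scl X n.
                    (SUP f\<in>W. INF g\<in>L. ereal (nrm (f - g))) \<le> ereal \<epsilon>}. enat n)"


section \<open>Square-integrable functions on the torus\<close>

text \<open>The dimension \<open>s\<close> is \<open>CARD('s)\<close>. Elements of \<open>L\<^sub>2\<close> are represented by functions; only
  their values on the cube matter, up to null sets.\<close>

definition torus :: "(real ^ 's) set" where
  "torus = cbox (\<chi> j. - pi) (\<chi> j. pi)"

definition L2_torus :: "(real ^ 's \<Rightarrow> complex) set" where
  "L2_torus = {f. f \<in> borel_measurable (lebesgue_on torus) \<and>
                  integrable (lebesgue_on torus) (\<lambda>x. (cmod (f x))\<^sup>2)}"

definition torus_inner :: "(real ^ 's \<Rightarrow> complex) \<Rightarrow> (real ^ 's \<Rightarrow> complex) \<Rightarrow> complex" where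
  "torus_inner f g =
     (LINT x|lebesgue_on torus. f x * cnj (g x)) / complex_of_real ((2 * pi) ^ CARD('s))"

definition torus_norm :: "(real ^ 's \<Rightarrow> complex) \<Rightarrow> real" where
  "torus_norm f = sqrt (Re (torus_inner f f))"

definition torus_char :: "int ^ 's \<Rightarrow> real ^ 's \<Rightarrow> complex" where
  "torus_char k x = exp (\<i> * complex_of_real (\<Sum>j\<in>UNIV. real_of_int (k $ j) * x $ j))"

definition fourier_coeff :: "(real ^ 's \<Rightarrow> complex) \<Rightarrow> int ^ 's \<Rightarrow> complex" where
  "fourier_coeff f k = torus_inner f (torus_char k)"

definition fun_scale :: "complex \<Rightarrow> ('x \<Rightarrow> complex) \<Rightarrow> 'x \<Rightarrow> complex" where
  "fun_scale c f = (\<lambda>x. c * f x)"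

lemma vector_space_fun_scale: "vector_space fun_scale"
  by unfold_locales (auto simp: fun_scale_def fun_eq_iff algebra_simps)


section \<open>Modified Korobov spaces\<close>

definition korobov_weight :: "real \<Rightarrow> int ^ 's \<Rightarrow> real" where
  "korobov_weight a k = (\<Prod>j\<in>UNIV. a + real_of_int \<bar>k $ j\<bar>)"

text \<open>The convolution identity \<open>f = \<kappa> * g\<close>, where \<open>\<kappa>\<close> is the distribution with Fourier
  coefficients \<open>korobov_weight a k powr (-r)\<close>, read on the level of Fourier coefficients.\<close>

definition korobov_convolution ::
    "real \<Rightarrow> real \<Rightarrow> (real ^ 's \<Rightarrow> complex) \<Rightarrow> (real ^ 's \<Rightarrow> complex) \<Rightarrow> bool" where
  "korobov_convolution r a g f \<longleftrightarrow>
     (\<forall>k. fourier_coeff f k = complex_of_real (korobov_weight a k powr (- r)) * fourier_coeff g k)"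

definition korobov_space :: "real \<Rightarrow> real \<Rightarrow> (real ^ 's \<Rightarrow> complex) set" where
  "korobov_space r a = {f \<in> L2_torus. \<exists>g \<in> L2_torus. korobov_convolution r a g f}"

text \<open>By completeness of the trigonometric system, \<open>g\<close> is determined by \<open>f\<close> up to a null set,
  so its norm is unique.\<close>

definition korobov_norm :: "real \<Rightarrow> real \<Rightarrow> (real ^ 's \<Rightarrow> complex) \<Rightarrow> real" where
  "korobov_norm r a f =
     (THE c. \<exists>g \<in> L2_torus. korobov_convolution r a g f \<and> c = torus_norm g)"

definition korobov_ball :: "real \<Rightarrow> real \<Rightarrow> (real ^ 's \<Rightarrow> complex) set" where
  "korobov_ball r a = {f \<in> korobov_space r a. korobov_norm r a f \<le> 1}"

end

theory Submission
  imports Defs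
begin

text \<open>Truncating the Fourier series of a function of the unit ball to the finite set of frequencies
  of weight at most \<open>T = \<epsilon> powr (-1/r)\<close> leaves an \<open>L\<^sub>2\<close>-error of at most \<open>\<epsilon>\<close>, by Parseval's
  identity. Rankin's trick bounds the number of these frequencies by
  \<open>T powr (1+q) * (\<Sum>m. (a + \<bar>m\<bar>) powr (-(1+q))) ^ s\<close>, and comparison of the sum with an integral and
  Bernoulli's inequality give the bound \<open>(a - 2/q) powr (-q)\<close> for the sum over \<open>m\<close>.
  The density of trigonometric polynomials in \<open>L\<^sub>2\<close>, which Parseval's identity needs, comes from
  the Stone-Weierstrass theorem on the torus embedded in \<open>complex ^ 's\<close>.\<close>

section \<open>Counting lattice points of bounded weight\<close>

text \<open>With x = 2/(qa) this reads (1 - x)^q (1 + qx) <= 1. It follows by multiplying the q-th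
  power of 1 - x <= exp (-x) with 1 + qx <= exp (qx).\<close>

lemma bernoulli_powr:
  fixes q a :: real
  assumes "q > 0" "a - 2 / q > 0" "a > 0"
  shows "a powr (- q) * (1 + 2 / a) \<le> (a - 2 / q) powr (- q)"
proof -
  define x where "x = 2 / (q * a)"
  have x: "a - 2 / q = a * (1 - x)" "0 < 1 - x" "q * x = 2 / a"
    using assms by (auto simp: x_def field_simps)
  have "(1 - x) powr q * (1 + q * x) \<le> exp (- x) powr q * exp (q * x)"
    using x(2) assms exp_ge_add_one_self[of "- x"] exp_ge_add_one_self[of "q * x"]
    by (intro mult_mono powr_mono2) (auto simp: x_def)
  also have "\<dots> = 1"
    by (simp add: powr_def flip: exp_add)
  finally have "1 + q * x \<le> (1 - x) powr (- q)"
    using x(2) by (simp add: powr_minus field_simps)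
  then have "a powr (- q) * (1 + q * x) \<le> a powr (- q) * (1 - x) powr (- q)"
    by (intro mult_left_mono) auto
  then show ?thesis
    using assms x by (simp add: powr_mult)
qed

text \<open>By the mean value theorem for \<open>t powr (- q)\<close> on [t, t + 1], the right-hand
  side is \<open>z powr (- (1 + q))\<close> for some z < t + 1, and this power is
  decreasing.\<close>

lemma powr_telescope_bound:
  fixes q t :: real
  assumes "q > 0" "t > 0"
  shows "(t + 1) powr (- (1 + q)) \<le> (t powr (- q) - (t + 1) powr (- q)) / q"
proof -
  have eq: "- q - 1 = - (1 + q)" by simp
  have "\<exists>z::real. t < z \<and> z < t + 1 \<and>
      (t + 1) powr (- q) - t powr (- q) = (t + 1 - t) * (- q * z powr (- q - 1))"
    using assms by (intro MVT2) (auto intro!: derivative_eq_intros simp: powr_diff)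
  then obtain z w where z: "t < z" "z < t + 1" "w = z powr (- (1 + q))"
      "(t + 1) powr (- q) - t powr (- q) = - q * w"
    unfolding eq by auto
  have "(t + 1) powr (- (1 + q)) \<le> w"
    unfolding z(3) using z assms by (intro powr_mono2') auto
  also have "w = (t powr (- q) - (t + 1) powr (- q)) / q"
    using z(4) assms by (simp add: field_simps)
  finally show ?thesis .
qed

text \<open>The subtracted term at N is what makes the induction close; it is dropped
  afterwards.\<close>

lemma sum_powr_telescope:
  fixes q a :: real
  assumes "q > 0" "a > 0"
  shows "(\<Sum>k=1..N. (a + real k) powr (- (1 + q))) \<le> (a powr (- q) - (a + real N) powr (- q)) / q"
proof (induction N)
  case (Suc N)
  have "(a + real (Suc N)) powr (- (1 + q))
      \<le> ((a + real N) powr (- q) - (a + real (Suc N)) powr (- q)) / q"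
    using powr_telescope_bound[of q "a + real N"] assms by (simp add: add_ac)
  with Suc show ?case
    by (simp add: diff_divide_distrib)
qed simp

lemma sum_int_powr_bound:
  fixes q a :: real
  assumes "q \<ge> 2" "a - 2 / q > 0" "a > 0"
  shows "(\<Sum>k=-int N..int N. (a + real_of_int \<bar>k\<bar>) powr (- (1 + q))) \<le> (a - 2 / q) powr (- q)"
proof -
  let ?f = "\<lambda>k::int. (a + real_of_int \<bar>k\<bar>) powr (- (1 + q))"
  let ?S = "\<Sum>k=1..N. (a + real k) powr (- (1 + q))"
  have pos: "sum ?f {1..int N} = ?S"
    by (rule sum.reindex_bij_witness[of _ int nat]) auto
  have neg: "sum ?f {-int N..-1} = ?S"
    by (rule sum.reindex_bij_witness[of _ "\<lambda>n. - int n" "\<lambda>k. nat (- k)"]) auto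
  have "{-int N..int N} = {-int N..-1} \<union> ({0} \<union> {1..int N})"
    by auto
  then have "sum ?f {-int N..int N} = sum ?f {-int N..-1} + (?f 0 + sum ?f {1..int N})"
    by (simp only:) (subst sum.union_disjoint; auto)
  also have "\<dots> = a powr (- (1 + q)) + 2 * ?S"
    using pos neg by simp
  also have "\<dots> \<le> a powr (- (1 + q)) + 2 * (a powr (- q) / q)"
  proof -
    have "?S \<le> (a powr (- q) - (a + real N) powr (- q)) / q"
      using sum_powr_telescope assms by auto
    also have "\<dots> \<le> a powr (- q) / q"
      using assms by (intro divide_right_mono) auto
    finally show ?thesis by simp
  qed
  \<comment> \<open>The term at 0 equals \<open>a powr (- q) / a\<close>, and q >= 2 bounds the two
    half-lines together by \<open>a powr (- q)\<close>. The sum is at most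
    \<open>a powr (- q)\<close> times 1 + 1/a, which leaves room for 2/a.\<close>
  also have "\<dots> \<le> a powr (- q) * (1 + 2 / a)"
  proof -
    have "- (1 + q) = - q - 1" by simp
    then have "a powr (- (1 + q)) = a powr (- q) / a"
      using assms by (simp only: powr_diff) simp
    moreover have "2 * (a powr (- q) / q) \<le> a powr (- q)"
      using assms by (simp add: field_simps)
    moreover have "0 \<le> a powr (- q) / a"
      using assms by simp
    ultimately show ?thesis
      by (simp add: algebra_simps)
  qed
  also have "\<dots> \<le> (a - 2 / q) powr (- q)"
    using assms by (intro bernoulli_powr) auto
  finally show ?thesis .
qed

section \<open>Lattice points in the hyperbolic cross\<close>

lemma korobov_weight_pos: "a > 0 \<Longrightarrow> korobov_weight a k > 0"
  unfolding korobov_weight_def by (intro prod_pos) (auto intro: add_pos_nonneg)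

text \<open>Rankin's trick: a lattice point of weight at most \<open>T\<close> contributes at least \<open>1\<close> to the sum of
  \<open>(T / korobov_weight a k) powr (1 + q)\<close>, which factors over the coordinates.\<close>

lemma card_hyperbolic_cross_le:
  fixes F :: "(int ^ 's) set"
  assumes "q \<ge> 2" "a - 2 / q > 0" "a > 0" "finite F"
    and F: "\<And>k. k \<in> F \<Longrightarrow> korobov_weight a k \<le> T"
  shows "real (card F) \<le> (a - 2 / q) powr (- q * real CARD('s)) * T powr (1 + q)"
proof -
  let ?f = "\<lambda>m::int. (a + real_of_int \<bar>m\<bar>) powr (- (1 + q))"
  \<comment> \<open>A crude common bound for all coordinates of points of F, so that F lies in a
    finite box. The final estimate is uniform in N.\<close>
  define N where "N = (\<Sum>k\<in>F. \<Sum>j\<in>UNIV. nat \<bar>k $ j\<bar>)"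
  have N: "k $ j \<in> {-int N..int N}" if "k \<in> F" for k j
  proof -
    have "nat \<bar>k $ j\<bar> \<le> (\<Sum>j\<in>UNIV. nat \<bar>k $ j\<bar>)"
      by (intro member_le_sum) auto
    also have "\<dots> \<le> N"
      unfolding N_def using that \<open>finite F\<close> by (intro member_le_sum) auto
    finally show ?thesis by auto
  qed
  have "1 \<le> (T powr (1 + q)) * korobov_weight a k powr (- (1 + q))" if "k \<in> F" for k
  proof -
    have "korobov_weight a k powr (1 + q) \<le> T powr (1 + q)"
      using F[OF that] korobov_weight_pos[of a k] assms by (intro powr_mono2) auto
    then show ?thesis
      using korobov_weight_pos[of a k] assms by (subst powr_minus) (simp add: field_simps)
  qed
  then have "real (card F) \<le> (\<Sum>k\<in>F. T powr (1 + q) * korobov_weight a k powr (- (1 + q)))"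
    using sum_mono[of F "\<lambda>_. 1::real"] by fastforce
  also have "\<dots> = T powr (1 + q) * (\<Sum>k\<in>F. \<Prod>j\<in>UNIV. ?f (k $ j))"
    unfolding korobov_weight_def using assms
    by (simp add: sum_distrib_left prod_powr_distrib)
  finally have card: "real (card F) \<le> T powr (1 + q) * (\<Sum>k\<in>F. \<Prod>j\<in>UNIV. ?f (k $ j))" .
  \<comment> \<open>Vectors are replaced by their coordinate functions, because the distributive law
    that factors the sum over the box is stated for \<open>PiE\<close>.\<close>
  have "(\<Sum>k\<in>F. \<Prod>j\<in>UNIV. ?f (k $ j)) = (\<Sum>g\<in>vec_nth ` F. \<Prod>j\<in>UNIV. ?f (g j))"
    by (subst sum.reindex) (auto simp: inj_on_def vec_nth_inject)
  also have "\<dots> \<le> (\<Sum>g\<in>PiE (UNIV :: 's set) (\<lambda>_. {-int N..int N}). \<Prod>j\<in>UNIV. ?f (g j))"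
  proof (rule sum_mono2)
    show "vec_nth ` F \<subseteq> PiE (UNIV :: 's set) (\<lambda>_. {-int N..int N})"
      using N by auto
  qed (auto intro!: finite_PiE prod_nonneg)
  also have "\<dots> = (\<Sum>k=-int N..int N. ?f k) ^ CARD('s)"
    by (subst prod_sum_PiE[symmetric]) auto
  also have "\<dots> \<le> ((a - 2 / q) powr (- q)) ^ CARD('s)"
    using sum_int_powr_bound assms by (intro power_mono) (auto intro: sum_nonneg)
  also have "\<dots> = (a - 2 / q) powr (- q * real CARD('s))"
    using assms by (simp add: powr_realpow[symmetric] powr_powr)
  finally have "T powr (1 + q) * (\<Sum>k\<in>F. \<Prod>j\<in>UNIV. ?f (k $ j))
      \<le> T powr (1 + q) * (a - 2 / q) powr (- q * real CARD('s))"
    by (intro mult_left_mono) auto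
  with card show ?thesis
    by (simp add: mult.commute)
qed

text \<open>The counting bound holds with one constant for all finite subsets, whereas an infinite
  set has finite subsets of every cardinality.\<close>

lemma finite_hyperbolic_cross:
  assumes "a > 0"
  shows "finite {k :: int ^ 's. korobov_weight a k \<le> T}"
proof (rule ccontr)
  assume inf: "infinite {k :: int ^ 's. korobov_weight a k \<le> T}"
  \<comment> \<open>Any q >= 2 with a - 2/q > 0 would do; here a - 2/q = a^2/(a + 1).\<close>
  define q where "q = 2 + 2 / a"
  have "a - 2 / q > 0"
    using assms by (simp add: q_def field_simps)
  then have bound: "real (card F) \<le> (a - 2 / q) powr (- q * real CARD('s)) * T powr (1 + q)"
    if "finite F" "F \<subseteq> {k :: int ^ 's. korobov_weight a k \<le> T}" for F
    using that assms by (intro card_hyperbolic_cross_le) (auto simp: q_def)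
  obtain n :: nat where "(a - 2 / q) powr (- q * real CARD('s)) * T powr (1 + q) < real n"
    using reals_Archimedean2 by blast
  moreover obtain F :: "(int ^ 's) set" where "finite F" "card F = n"
      "F \<subseteq> {k. korobov_weight a k \<le> T}"
    using infinite_arbitrarily_large[OF inf] by blast
  ultimately show False
    using bound by fastforce
qed

section \<open>Fourier coefficients on the torus\<close>

text \<open>Fubini's theorem, transported along the description of \<open>lborel\<close> as an image
  of the product measure indexed by \<open>Basis\<close>.\<close>

lemma integral_lborel_prod:
  fixes f :: "'a::euclidean_space \<Rightarrow> real \<Rightarrow> complex"
  assumes "\<And>b. b \<in> Basis \<Longrightarrow> integrable lborel (f b)"
  shows "(\<integral>x. (\<Prod>b\<in>Basis. f b (x \<bullet> b)) \<partial>lborel) = (\<Prod>b\<in>(Basis::'a set). \<integral>x. f b x \<partial>lborel)"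
proof -
  interpret product_sigma_finite "\<lambda>_::'a. lborel :: real measure" ..
  have [measurable]: "f b \<in> borel_measurable borel" if "b \<in> Basis" for b
    using borel_measurable_integrable[OF assms[OF that]] by simp
  have "(\<integral>x. (\<Prod>b\<in>Basis. f b (x \<bullet> b)) \<partial>lborel)
      = (\<integral>x. (\<Prod>b\<in>Basis. f b (x b)) \<partial>(\<Pi>\<^sub>M b\<in>(Basis::'a set). lborel))"
    by (subst lborel_eq, subst integral_distr) (auto intro!: Bochner_Integration.integral_cong prod.cong)
  also have "\<dots> = (\<Prod>b\<in>Basis. \<integral>x. f b x \<partial>lborel)"
    using assms by (intro product_integral_prod) auto
  finally show ?thesis .
qed

lemma torus_sets [measurable, simp]: "torus \<in> sets lebesgue"
  by (simp add: torus_def)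

lemma integral_cis_period:
  "(\<integral>x. indicator {-pi..pi} x *\<^sub>R cis (of_int m * x) \<partial>lborel) = (if m = 0 then 2 * pi else 0)"
proof (cases "m = 0")
  case True
  then show ?thesis by (simp add: scaleR_conv_of_real)
next
  case False
  have "((\<lambda>x. cis (of_int m * x) / (\<i> * of_int m)) has_vector_derivative cis (of_int m * x))
      (at x within A)" for x A
  proof -
    have "((\<lambda>z. exp (\<i> * of_int m * z) / (\<i> * of_int m))
        has_field_derivative exp (\<i> * of_int m * of_real x)) (at (of_real x))"
      using False by (auto intro!: derivative_eq_intros)
    from has_vector_derivative_real_field[OF this] show ?thesis
      by (simp add: cis_conv_exp mult.assoc)
  qed
  then have "(\<integral>x. indicator {-pi..pi} x *\<^sub>R cis (of_int m * x) \<partial>lborel)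
     = cis (of_int m * pi) / (\<i> * of_int m) - cis (of_int m * - pi) / (\<i> * of_int m)"
    by (intro integral_FTC_Icc) (auto intro!: continuous_intros)
  \<comment> \<open>The two arguments differ by the multiple 2 pi m of the period, so the boundary
    terms cancel.\<close>
  also have "cis (of_int m * pi) = cis (of_int m * - pi)"
    by (simp add: complex_eq_iff sin_zero_iff_int2)
  finally show ?thesis
    using False by simp
qed

lemma torus_char_eq_prod: "torus_char k x = (\<Prod>j\<in>UNIV. cis (of_int (k $ j) * x $ j))"
  by (simp add: torus_char_def cis_conv_exp exp_sum sum_distrib_left mult_ac)

lemma integral_torus_char:
  fixes k :: "int ^ 's"
  shows "(LINT x|lebesgue_on torus. torus_char k x) = (if k = 0 then (2 * pi) ^ CARD('s) else 0)"
proof -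
  \<comment> \<open>The product formula runs over basis vectors, so \<open>axis_index\<close> is
    used to recover the coordinate j from \<open>axis j 1\<close>.\<close>
  let ?g = "\<lambda>(b :: real ^ 's) x. indicator {-pi..pi} x *\<^sub>R cis (of_int (k $ axis_index b) * x)"
  have basis: "(Basis :: (real ^ 's) set) = range (\<lambda>j. axis j 1)"
    by (auto simp: Basis_vec_def)
  have inj: "inj (\<lambda>j. axis j (1 :: real) :: real ^ 's)"
    by (auto simp: inj_def axis_eq_axis)
  have int: "integrable lborel (?g b)" for b
    by (intro borel_integrable_compact continuous_intros) auto
  have ai: "axis_index (axis j (1 :: real) :: real ^ 's) = j" for j
    unfolding axis_index_def by (auto simp: axis_eq_axis intro!: the_equality)
  have "(LINT x|lebesgue_on torus. torus_char k x)
      = (LINT x|lebesgue. indicator torus x *\<^sub>R torus_char k x)"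
    by (intro integral_restrict_space) simp
  also have "\<dots> = (LINT x|lborel. indicator torus x *\<^sub>R torus_char k x)"
    by (intro integral_completion) (auto simp: torus_def torus_char_def)
  also have "\<dots> = (LINT x|lborel. (\<Prod>b\<in>Basis. ?g b (x \<bullet> b)))"
  proof (rule Bochner_Integration.integral_cong)
    fix x :: "real ^ 's"
    have "(\<Prod>b\<in>Basis. ?g b (x \<bullet> b))
        = (\<Prod>j\<in>UNIV. indicator {-pi..pi} (x $ j) *\<^sub>R cis (of_int (k $ j) * x $ j))"
      unfolding basis using inj by (simp add: prod.reindex ai inner_axis)
    also have "\<dots> = indicator torus x *\<^sub>R torus_char k x"
    proof (cases "x \<in> torus")
      case True
      then show ?thesis
        by (simp add: torus_char_eq_prod torus_def mem_box_cart)
    next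
      case False
      then obtain j where "x $ j \<notin> {-pi..pi}"
        by (auto simp: torus_def mem_box_cart)
      then have "indicator {-pi..pi} (x $ j) *\<^sub>R cis (of_int (k $ j) * x $ j) = 0"
        by simp
      then have "(\<Prod>j\<in>UNIV. indicator {-pi..pi} (x $ j) *\<^sub>R cis (of_int (k $ j) * x $ j)) = 0"
        by (intro prod_zero bexI[of _ j]) auto
      then show ?thesis
        using False by simp
    qed
    finally show "indicator torus x *\<^sub>R torus_char k x = (\<Prod>b\<in>Basis. ?g b (x \<bullet> b))" ..
  qed simp
  also have "\<dots> = (\<Prod>b\<in>(Basis :: (real ^ 's) set). \<integral>x. ?g b x \<partial>lborel)"
    by (intro integral_lborel_prod int)
  also have "\<dots> = (\<Prod>j\<in>(UNIV :: 's set). if k $ j = 0 then 2 * pi else 0)"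
    unfolding basis using inj by (simp add: prod.reindex ai integral_cis_period)
  also have "\<dots> = (if k = 0 then (2 * pi) ^ CARD('s) else 0)"
    by (auto simp: vec_eq_iff)
  finally show ?thesis .
qed

section \<open>Square-integrable functions on the torus\<close>

abbreviation torus_measure :: "(real ^ 's) measure" where
  "torus_measure \<equiv> lebesgue_on torus"

lemma finite_measure_torus: "finite_measure torus_measure"
  by (rule finite_measureI) (auto simp: emeasure_restrict_space torus_def emeasure_lborel_cbox_eq)

lemma cnj_torus_char: "cnj (torus_char k x) = torus_char (- k) x"
  by (simp add: torus_char_def exp_cnj sum_negf)

lemma torus_char_mult: "torus_char k x * torus_char l x = torus_char (k + l) x"
  by (simp add: torus_char_def exp_add[symmetric] sum.distrib distrib_left distrib_right)

lemma continuous_torus_char: "continuous_on A (torus_char k)"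
  unfolding torus_char_def[abs_def] by (intro continuous_intros)

lemma L2_borel: "f \<in> L2_torus \<Longrightarrow> f \<in> borel_measurable torus_measure"
  by (simp add: L2_torus_def)

lemma L2_integrable: "f \<in> L2_torus \<Longrightarrow> integrable torus_measure (\<lambda>x. (cmod (f x))\<^sup>2)"
  by (simp add: L2_torus_def)

lemma L2_bounded:
  assumes [measurable]: "f \<in> borel_measurable torus_measure"
    and "\<And>x. x \<in> torus \<Longrightarrow> cmod (f x) \<le> M"
  shows "f \<in> L2_torus"
proof -
  interpret finite_measure torus_measure by (rule finite_measure_torus)
  have "integrable torus_measure (\<lambda>x. (cmod (f x))\<^sup>2)"
    using assms by (intro integrable_const_bound[of _ "M\<^sup>2"]) (auto intro!: AE_I2 power_mono)
  then show ?thesis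
    by (simp add: L2_torus_def)
qed

lemma L2_continuous:
  assumes "continuous_on torus f"
  shows "f \<in> L2_torus"
proof -
  have "compact (f ` torus)"
    using assms by (intro compact_continuous_image) (auto simp: torus_def)
  then obtain M where "\<And>x. x \<in> torus \<Longrightarrow> cmod (f x) \<le> M"
    using compact_imp_bounded bounded_iff by (metis imageI)
  then show ?thesis
    using assms by (intro L2_bounded continuous_imp_measurable_on_sets_lebesgue) auto
qed

lemma L2_torus_char: "torus_char k \<in> L2_torus"
  by (intro L2_continuous continuous_torus_char)

lemma cmod_diff_square_le: "(cmod (z - w))\<^sup>2 \<le> 2 * (cmod z)\<^sup>2 + 2 * (cmod w)\<^sup>2"
proof -
  have "(cmod (z - w))\<^sup>2 \<le> (cmod z + cmod w)\<^sup>2"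
    by (intro power_mono norm_triangle_ineq4) auto
  also have "\<dots> \<le> 2 * (cmod z)\<^sup>2 + 2 * (cmod w)\<^sup>2"
    using zero_le_power2[of "cmod z - cmod w"] by (simp add: power2_eq_square algebra_simps)
  finally show ?thesis .
qed

lemma L2_diff:
  assumes "f \<in> L2_torus" "g \<in> L2_torus"
  shows "(\<lambda>x. f x - g x) \<in> L2_torus"
proof -
  note [measurable] = assms[THEN L2_borel]
  have "integrable torus_measure (\<lambda>x. (cmod (f x - g x))\<^sup>2)"
    by (rule Bochner_Integration.integrable_bound
          [of _ "\<lambda>x. 2 * (cmod (f x))\<^sup>2 + 2 * (cmod (g x))\<^sup>2"])
      (use assms in \<open>auto intro!: AE_I2 cmod_diff_square_le simp: L2_integrable\<close>)
  then show ?thesis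
    by (simp add: L2_torus_def)
qed

lemma L2_scale: "f \<in> L2_torus \<Longrightarrow> (\<lambda>x. c * f x) \<in> L2_torus"
  by (auto simp: L2_torus_def norm_mult power_mult_distrib)

lemma L2_add:
  assumes "f \<in> L2_torus" "g \<in> L2_torus"
  shows "(\<lambda>x. f x + g x) \<in> L2_torus"
  using L2_diff[OF assms(1) L2_scale[OF assms(2), of "-1"]] by simp

lemma L2_mult_integrable:
  assumes "f \<in> L2_torus" "g \<in> L2_torus"
  shows "integrable torus_measure (\<lambda>x. f x * cnj (g x))"
proof (rule Bochner_Integration.integrable_bound[of _ "\<lambda>x. (cmod (f x))\<^sup>2 + (cmod (g x))\<^sup>2"])
  note [measurable] = assms[THEN L2_borel]
  show "(\<lambda>x. f x * cnj (g x)) \<in> borel_measurable torus_measure"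
    by (intro borel_measurable_times borel_measurable_continuous_on[of cnj] continuous_intros)
      measurable
  have "cmod (f x) * cmod (g x) \<le> (cmod (f x))\<^sup>2 + (cmod (g x))\<^sup>2" for x
  proof -
    have "0 \<le> cmod (f x) * cmod (g x)"
      by simp
    moreover have "2 * (cmod (f x) * cmod (g x)) \<le> (cmod (f x))\<^sup>2 + (cmod (g x))\<^sup>2"
      using sum_squares_bound[of "cmod (f x)" "cmod (g x)"] by (simp add: mult.assoc)
    ultimately show ?thesis by linarith
  qed
  then show "AE x in torus_measure. norm (f x * cnj (g x)) \<le> norm ((cmod (f x))\<^sup>2 + (cmod (g x))\<^sup>2)"
    by (auto simp: norm_mult)
qed (use assms in \<open>auto simp: L2_integrable\<close>)

section \<open>Inner products, best approximation and Bessel's inequality\<close>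

lemma torus_inner_diff_left:
  assumes "f \<in> L2_torus" "g \<in> L2_torus" "h \<in> L2_torus"
  shows "torus_inner (\<lambda>x. f x - g x) h = torus_inner f h - torus_inner g h"
  using assms by (simp add: torus_inner_def L2_mult_integrable left_diff_distrib diff_divide_distrib)

lemma torus_inner_scale_left: "torus_inner (\<lambda>x. c * f x) h = c * torus_inner f h"
  by (simp add: torus_inner_def mult.assoc)

lemma torus_inner_commute: "torus_inner f g = cnj (torus_inner g f)"
proof -
  have "(LINT x|torus_measure. f x * cnj (g x)) = (LINT x|torus_measure. cnj (g x * cnj (f x)))"
    by (simp add: mult.commute)
  also have "\<dots> = cnj (LINT x|torus_measure. g x * cnj (f x))"
    by (rule Bochner_Integration.integral_cnj)
  finally show ?thesis
    by (simp add: torus_inner_def)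
qed

lemma torus_inner_char: "torus_inner (torus_char k) (torus_char l) = (if k = l then 1 else 0)"
  by (simp add: torus_inner_def cnj_torus_char torus_char_mult integral_torus_char)

lemma torus_inner_self:
  fixes f :: "real ^ 's \<Rightarrow> complex"
  shows "torus_inner f f
    = complex_of_real ((LINT x|torus_measure. (cmod (f x))\<^sup>2) / (2 * pi) ^ CARD('s))"
  by (simp add: torus_inner_def complex_norm_square[symmetric] del: of_real_power)

lemma torus_norm_square:
  fixes f :: "real ^ 's \<Rightarrow> complex"
  shows "(torus_norm f)\<^sup>2 = (LINT x|torus_measure. (cmod (f x))\<^sup>2) / (2 * pi) ^ CARD('s)"
  by (simp add: torus_norm_def torus_inner_self)

lemma torus_norm_nonneg: "torus_norm f \<ge> 0"
  by (simp add: torus_norm_def torus_inner_self)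

lemma torus_inner_self_norm: "torus_inner f f = complex_of_real ((torus_norm f)\<^sup>2)"
  by (simp only: torus_norm_square torus_inner_self)

text \<open>Expanding the inner product and completing the square in c, since the character has norm
  1. The dependence on c is isolated in the last term.\<close>

lemma torus_norm_diff_char:
  assumes "f \<in> L2_torus"
  shows "(torus_norm (\<lambda>x. f x - c * torus_char k x))\<^sup>2
    = (torus_norm f)\<^sup>2 - (cmod (fourier_coeff f k))\<^sup>2 + (cmod (fourier_coeff f k - c))\<^sup>2"
proof -
  let ?e = "torus_char k" and ?z = "fourier_coeff f k"
  let ?h = "\<lambda>x. f x - c * ?e x"
  have L2: "?e \<in> L2_torus" "(\<lambda>x. c * ?e x) \<in> L2_torus" "?h \<in> L2_torus"
    by (intro L2_torus_char L2_scale L2_diff assms)+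
  \<comment> \<open>Linearity has been established in the left argument; conjugate symmetry carries
    it over to the right one.\<close>
  have fh: "torus_inner f ?h = torus_inner f f - cnj c * ?z"
    by (subst torus_inner_commute, subst torus_inner_diff_left)
      (use assms L2 in \<open>auto simp: torus_inner_scale_left fourier_coeff_def
         torus_inner_commute[of f "torus_char k", symmetric] torus_inner_commute[of f f, symmetric]\<close>)
  have eh: "torus_inner ?e ?h = cnj ?z - cnj c"
    by (subst torus_inner_commute, subst torus_inner_diff_left)
      (use assms L2 in \<open>auto simp: torus_inner_scale_left fourier_coeff_def torus_inner_char\<close>)
  have "torus_inner ?h ?h = torus_inner f f - cnj c * ?z - c * (cnj ?z - cnj c)"
    by (subst torus_inner_diff_left) (use assms L2 in \<open>auto simp: torus_inner_scale_left fh eh\<close>)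
  then have "complex_of_real ((torus_norm ?h)\<^sup>2)
      = complex_of_real ((torus_norm f)\<^sup>2) - cnj c * ?z - c * (cnj ?z - cnj c)"
    by (simp only: torus_inner_self_norm)
  also have "\<dots> = complex_of_real ((torus_norm f)\<^sup>2 - (cmod ?z)\<^sup>2 + (cmod (?z - c))\<^sup>2)"
    by (simp only: of_real_add of_real_diff complex_norm_square) (simp add: algebra_simps)
  finally show ?thesis
    using of_real_eq_iff by blast
qed

text \<open>Orthogonality: removing one frequency leaves the other coefficients unchanged, so
  characters can be subtracted one at a time.\<close>

lemma fourier_coeff_diff_char:
  assumes "f \<in> L2_torus" "k \<noteq> l"
  shows "fourier_coeff (\<lambda>x. f x - c * torus_char l x) k = fourier_coeff f k"
  unfolding fourier_coeff_def using assms
  by (subst torus_inner_diff_left) (auto simp: torus_inner_scale_left torus_inner_char intro: L2_scale L2_torus_char)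

text \<open>The coefficients c are arbitrary on purpose. The Fourier coefficients give Bessel's
  inequality and the truncation error; the coefficients of an approximating polynomial give
  Parseval's identity.\<close>

lemma torus_norm_diff_sum_char:
  assumes "finite F" "f \<in> L2_torus"
  shows "(torus_norm (\<lambda>x. f x - (\<Sum>k\<in>F. c k * torus_char k x)))\<^sup>2
    = (torus_norm f)\<^sup>2 - (\<Sum>k\<in>F. (cmod (fourier_coeff f k))\<^sup>2)
        + (\<Sum>k\<in>F. (cmod (fourier_coeff f k - c k))\<^sup>2)"
  using assms
proof (induction F arbitrary: f rule: finite_induct)
  case (insert k F)
  let ?g = "\<lambda>x. f x - c k * torus_char k x"
  have g: "?g \<in> L2_torus"
    by (intro L2_torus_char L2_scale L2_diff insert.prems)
  have coeff: "fourier_coeff ?g l = fourier_coeff f l" if "l \<in> F" for l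
    using insert that by (intro fourier_coeff_diff_char) auto
  have "(torus_norm (\<lambda>x. f x - (\<Sum>l\<in>insert k F. c l * torus_char l x)))\<^sup>2
      = (torus_norm (\<lambda>x. ?g x - (\<Sum>l\<in>F. c l * torus_char l x)))\<^sup>2"
    using insert by (simp add: algebra_simps)
  also have "\<dots> = (torus_norm ?g)\<^sup>2 - (\<Sum>l\<in>F. (cmod (fourier_coeff f l))\<^sup>2)
        + (\<Sum>l\<in>F. (cmod (fourier_coeff f l - c l))\<^sup>2)"
    using insert.IH[OF g] coeff by simp
  finally show ?case
    using insert by (simp add: torus_norm_diff_char)
qed simp

lemma bessel_inequality:
  assumes "finite F" "f \<in> L2_torus"
  shows "(\<Sum>k\<in>F. (cmod (fourier_coeff f k))\<^sup>2) \<le> (torus_norm f)\<^sup>2"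
  using torus_norm_diff_sum_char[OF assms, of "fourier_coeff f"] 
    zero_le_power2[of "torus_norm (\<lambda>x. f x - (\<Sum>k\<in>F. fourier_coeff f k * torus_char k x))"]
  by simp

section \<open>Density of trigonometric polynomials\<close>

definition trig_poly :: "(real ^ 's \<Rightarrow> complex) \<Rightarrow> bool" where
  "trig_poly p \<longleftrightarrow> (\<exists>F c. finite F \<and> p = (\<lambda>x. \<Sum>k\<in>F. c k * torus_char k x))"

lemma trig_poly_monomial: "trig_poly (\<lambda>x. c * torus_char k x)"
  unfolding trig_poly_def by (rule exI[of _ "{k}"], rule exI[of _ "\<lambda>_. c"]) auto

lemma trig_poly_const: "trig_poly (\<lambda>x. c)"
  using trig_poly_monomial[of c 0] by (simp add: torus_char_def)

lemma trig_poly_add: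
  assumes "trig_poly p" "trig_poly p'"
  shows "trig_poly (\<lambda>x. p x + p' x)"
proof -
  obtain F c F' c' where *: "finite F" "p = (\<lambda>x. \<Sum>k\<in>F. c k * torus_char k x)"
      "finite F'" "p' = (\<lambda>x. \<Sum>k\<in>F'. c' k * torus_char k x)"
    using assms unfolding trig_poly_def by blast
  \<comment> \<open>Both coefficient families are extended by zero to the union of the frequency
    sets.\<close>
  define d where "d k = (if k \<in> F then c k else 0) + (if k \<in> F' then c' k else 0)" for k
  have "(\<Sum>k\<in>F. c k * torus_char k x) + (\<Sum>k\<in>F'. c' k * torus_char k x)
      = (\<Sum>k\<in>F \<union> F'. d k * torus_char k x)" for x
  proof -
    have "(\<Sum>k\<in>F. c k * torus_char k x)
        = (\<Sum>k\<in>F \<union> F'. (if k \<in> F then c k else 0) * torus_char k x)"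
      using * by (intro sum.mono_neutral_cong_left) auto
    moreover have "(\<Sum>k\<in>F'. c' k * torus_char k x)
        = (\<Sum>k\<in>F \<union> F'. (if k \<in> F' then c' k else 0) * torus_char k x)"
      using * by (intro sum.mono_neutral_cong_left) auto
    ultimately show ?thesis
      by (simp add: d_def distrib_right sum.distrib)
  qed
  then show ?thesis
    using * unfolding trig_poly_def by (metis finite_UnI)
qed

lemma trig_poly_sum: "(\<And>i. i \<in> I \<Longrightarrow> trig_poly (p i)) \<Longrightarrow> trig_poly (\<lambda>x. \<Sum>i\<in>I. p i x)"
  by (induction I rule: infinite_finite_induct) (auto intro: trig_poly_const trig_poly_add)

lemma trig_poly_mult:
  assumes "trig_poly p" "trig_poly p'"
  shows "trig_poly (\<lambda>x. p x * p' x)"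
proof -
  obtain F c F' c' where *: "finite F" "p = (\<lambda>x. \<Sum>k\<in>F. c k * torus_char k x)"
      "finite F'" "p' = (\<lambda>x. \<Sum>k\<in>F'. c' k * torus_char k x)"
    using assms unfolding trig_poly_def by blast
  \<comment> \<open>Different pairs (k, l) may share the frequency k + l, so the product is treated
    as a sum of monomials instead of collecting coefficients.\<close>
  have "p x * p' x = (\<Sum>k\<in>F. \<Sum>l\<in>F'. (c k * c' l) * torus_char (k + l) x)" for x
    unfolding * sum_product by (intro sum.cong) (simp_all flip: torus_char_mult)
  then show ?thesis
    by (simp add: trig_poly_sum trig_poly_monomial)
qed

lemma continuous_trig_poly: "trig_poly p \<Longrightarrow> continuous_on A p"
  unfolding trig_poly_def by (auto intro!: continuous_intros continuous_torus_char)

section \<open>Uniform approximation by Stone-Weierstrass\<close>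

lemma torus_char_axis: "torus_char (axis j m) x = cis (of_int m * x $ j)"
proof -
  have "(\<Sum>i\<in>UNIV. real_of_int (axis j m $ i) * x $ i) = (\<Sum>i\<in>UNIV. if i = j then of_int m * x $ j else 0)"
    by (intro sum.cong) (auto simp: axis_def)
  then show ?thesis
    by (simp add: torus_char_def cis_conv_exp)
qed

text \<open>Opposite faces of the cube are glued, so the image of the cube is a product of unit
  circles: a compact set on which the real coordinates are the cosines and sines of the
  \<open>x $ j\<close>.\<close>

definition torus_embed :: "real ^ 's \<Rightarrow> complex ^ 's" where
  "torus_embed x = (\<chi> j. cis (x $ j))"

text \<open>Trigonometric polynomials form an algebra, so only linear functionals need work. These
  are combinations of cosines and sines of the coordinates, which Euler's formulas express by the
  characters with frequencies 1 and -1 on one axis.\<close>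

lemma trig_poly_real_polynomial:
  assumes "real_polynomial_function r"
  shows "trig_poly (\<lambda>x. complex_of_real (r (torus_embed x)))"
  using assms
proof induction
  case (linear f)
  have coord: "trig_poly (\<lambda>x. complex_of_real (torus_embed x \<bullet> b))" if "b \<in> Basis" for b
  proof -
    obtain j where "b = axis j 1 \<or> b = axis j \<i>"
      using \<open>b \<in> Basis\<close> by (auto simp: Basis_vec_def Basis_complex_def)
    then show ?thesis
    proof
      assume b: "b = axis j 1"
      have "complex_of_real (torus_embed x \<bullet> b)
          = (1/2) * torus_char (axis j 1) x + (1/2) * torus_char (axis j (-1)) x" for x
        by (simp add: b torus_char_axis torus_embed_def inner_axis complex_eq_iff inner_complex_def)
      then show ?thesis
        by (simp only: trig_poly_add trig_poly_monomial)
    next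
      assume b: "b = axis j \<i>"
      have "complex_of_real (torus_embed x \<bullet> b)
          = (-\<i>/2) * torus_char (axis j 1) x + (\<i>/2) * torus_char (axis j (-1)) x" for x
        by (simp add: b torus_char_axis torus_embed_def inner_axis complex_eq_iff inner_complex_def)
      then show ?thesis
        by (simp only: trig_poly_add trig_poly_monomial)
    qed
  qed
  have "f (torus_embed x) = (\<Sum>b\<in>Basis. (torus_embed x \<bullet> b) * f b)" for x
  proof -
    interpret bounded_linear f by fact
    have "f (torus_embed x) = f (\<Sum>b\<in>Basis. (torus_embed x \<bullet> b) *\<^sub>R b)"
      by (simp add: euclidean_representation)
    then show ?thesis
      by (simp add: sum scaleR)
  qed
  then show ?case
    using coord by (auto intro!: trig_poly_sum trig_poly_mult trig_poly_const)
qed (auto intro: trig_poly_const trig_poly_add trig_poly_mult)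

lemma trig_poly_polynomial_function:
  assumes "polynomial_function (q :: complex ^ 's \<Rightarrow> complex)"
  shows "trig_poly (\<lambda>x. q (torus_embed x))"
proof -
  have "real_polynomial_function (Re \<circ> q)" "real_polynomial_function (Im \<circ> q)"
    using assms bounded_linear_Re bounded_linear_Im by (auto simp: polynomial_function_def)
  then have "trig_poly (\<lambda>x. complex_of_real (Re (q (torus_embed x))) + \<i> * complex_of_real (Im (q (torus_embed x))))"
    using trig_poly_real_polynomial by (fastforce intro!: trig_poly_add trig_poly_mult trig_poly_const)
  then show ?thesis
    by (simp add: complex_eq[symmetric])
qed

definition torus_box :: "(real ^ 's) set" where
  "torus_box = box (\<chi> j. - pi) (\<chi> j. pi)"

text \<open>A function that vanishes on the boundary of the cube descends to the embedded torus, and there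
  it is a uniform limit of polynomials in the coordinates and their conjugates.\<close>

lemma uniform_trig_approx:
  fixes h :: "real ^ 's \<Rightarrow> complex"
  assumes cont: "continuous_on torus h" and zero: "\<And>x. x \<in> torus - torus_box \<Longrightarrow> h x = 0"
    and "\<delta> > 0"
  shows "\<exists>p. trig_poly p \<and> (\<forall>x\<in>torus. cmod (h x - p x) < \<delta>)"
proof -
  \<comment> \<open>\<open>Arg\<close> has values in (-pi, pi], so it inverts the embedding on the
    open box. On the boundary it may turn a coordinate -pi into pi, but the recovered point is again
    a boundary point and h vanishes at both.\<close>
  define H :: "complex ^ 's \<Rightarrow> complex" where "H z = h (\<chi> j. Arg (z $ j))" for z
  let ?K = "torus_embed ` torus :: (complex ^ 's) set"
  have H: "H (torus_embed x) = h x" if x: "x \<in> torus" for x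
  proof (cases "x \<in> torus_box")
    case True
    then have "Arg (cis (x $ j)) = x $ j" for j
      by (intro cis_Arg_unique) (auto simp: torus_box_def mem_box_cart less_imp_le)
    then have "(\<chi> j. Arg (torus_embed x $ j)) = x"
      by (simp add: torus_embed_def vec_eq_iff)
    then show ?thesis
      by (simp add: H_def)
  next
    case False
    then obtain j where j: "x $ j = pi \<or> x $ j = - pi"
      using x by (fastforce simp: torus_box_def torus_def mem_box_cart not_less intro: antisym)
    let ?y = "(\<chi> j. Arg (torus_embed x $ j)) :: real ^ 's"
    have "?y \<in> torus"
      using Arg_bounded by (auto simp: torus_def mem_box_cart less_imp_le)
    moreover have "cis (x $ j) = cis pi"
      using j by (auto simp: complex_eq_iff)
    then have "?y $ j = pi"
      using cis_Arg_unique[of "cis pi" pi] by (simp add: torus_embed_def)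
    then have "?y \<notin> torus_box"
      by (auto simp: torus_box_def mem_box_cart intro!: exI[of _ j])
    ultimately show ?thesis
      using zero x False by (simp add: H_def)
  qed
  have cont_embed: "continuous_on A torus_embed" for A :: "(real ^ 's) set"
    unfolding torus_embed_def[abs_def] by (intro continuous_intros)
  have "compact (torus :: (real ^ 's) set)"
    by (simp add: torus_def)
  then have K: "compact ?K"
    by (intro compact_continuous_image cont_embed)
  \<comment> \<open>\<open>Arg\<close> is discontinuous, so continuity comes from compactness: the
    preimage of a closed set under H is the image of a compact subset of the cube.\<close>
  have "continuous_on ?K H"
  proof (subst continuous_on_closed_vimage)
    show "closed ?K"
      using K by (rule compact_imp_closed)
    show "\<forall>B. closed B \<longrightarrow> closed (H -` B \<inter> ?K)"
    proof (intro allI impI)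
      fix B :: "complex set" assume "closed B"
      have "H -` B \<inter> ?K = torus_embed ` (h -` B \<inter> torus)"
        using H by auto
      moreover have "closed (h -` B \<inter> torus)"
        using cont \<open>closed B\<close> continuous_on_closed_vimage[of torus h] by (auto simp: torus_def)
      then have "compact (torus \<inter> (h -` B \<inter> torus))"
        using \<open>compact torus\<close> by (intro compact_Int_closed)
      then have "compact (torus_embed ` (h -` B \<inter> torus))"
        by (intro compact_continuous_image cont_embed) (simp add: Int_ac)
      ultimately show "closed (H -` B \<inter> ?K)"
        by (simp add: compact_imp_closed)
    qed
  qed
  then obtain q where q: "polynomial_function q" "\<forall>z\<in>?K. cmod (H z - q z) < \<delta>"
    using Stone_Weierstrass_polynomial_function[OF K _ \<open>\<delta> > 0\<close>] by blast
  then show ?thesis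
    using H by (intro exI[of _ "\<lambda>x. q (torus_embed x)"]) (auto intro: trig_poly_polynomial_function)
qed

section \<open>Mean-square density by dominated convergence\<close>

lemma L2_diff_integrable:
  assumes "f \<in> L2_torus" "g \<in> L2_torus"
  shows "integrable torus_measure (\<lambda>x. (cmod (f x - g x))\<^sup>2)"
  using L2_diff[OF assms] by (rule L2_integrable)

text \<open>The distance is squared and left unnormalised, so that theorems on integrals apply
  directly.\<close>

definition trig_closure :: "(real ^ 's \<Rightarrow> complex) set" where
  "trig_closure = {f \<in> L2_torus. \<forall>\<delta>>0. \<exists>p. trig_poly p \<and>
     (LINT x|torus_measure. (cmod (f x - p x))\<^sup>2) < \<delta>}"

lemma trig_poly_L2: "trig_poly p \<Longrightarrow> p \<in> L2_torus"
  by (intro L2_continuous continuous_trig_poly)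

lemma trig_closure_L2: "f \<in> trig_closure \<Longrightarrow> f \<in> L2_torus"
  by (simp add: trig_closure_def)

lemma trig_closure_closed:
  assumes f: "f \<in> L2_torus"
    and approx: "\<And>\<delta>. \<delta> > 0 \<Longrightarrow> \<exists>g\<in>trig_closure. (LINT x|torus_measure. (cmod (f x - g x))\<^sup>2) < \<delta>"
  shows "f \<in> trig_closure"
  unfolding trig_closure_def
proof (intro CollectI conjI f allI impI)
  \<comment> \<open>The squared distance obeys the triangle inequality up to a factor 2, so two
    errors below \<delta>/4 add up to less than \<delta>.\<close>
  fix \<delta> :: real assume "\<delta> > 0"
  then obtain g where g: "g \<in> trig_closure" "(LINT x|torus_measure. (cmod (f x - g x))\<^sup>2) < \<delta> / 4"
    using approx[of "\<delta> / 4"] by auto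
  from \<open>\<delta> > 0\<close> have "\<delta> / 4 > 0" by simp
  with g(1) obtain p where p: "trig_poly p" "(LINT x|torus_measure. (cmod (g x - p x))\<^sup>2) < \<delta> / 4"
    unfolding trig_closure_def by blast
  have L2: "g \<in> L2_torus" "p \<in> L2_torus"
    using g p by (auto intro: trig_closure_L2 trig_poly_L2)
  have int: "integrable torus_measure (\<lambda>x. (cmod (f x - g x))\<^sup>2)"
      "integrable torus_measure (\<lambda>x. (cmod (g x - p x))\<^sup>2)"
      "integrable torus_measure (\<lambda>x. (cmod (f x - p x))\<^sup>2)"
    by (rule L2_diff_integrable[OF f L2(1)] L2_diff_integrable[OF L2] L2_diff_integrable[OF f L2(2)])+
  have "(LINT x|torus_measure. (cmod (f x - p x))\<^sup>2)
      \<le> (LINT x|torus_measure. 2 * (cmod (f x - g x))\<^sup>2 + 2 * (cmod (g x - p x))\<^sup>2)"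
  proof (intro integral_mono)
    show "(cmod (f x - p x))\<^sup>2 \<le> 2 * (cmod (f x - g x))\<^sup>2 + 2 * (cmod (g x - p x))\<^sup>2" for x
      using cmod_diff_square_le[of "f x - g x" "p x - g x"] by (simp add: norm_minus_commute)
  qed (use int in auto)
  also have "\<dots> = 2 * (LINT x|torus_measure. (cmod (f x - g x))\<^sup>2)
      + 2 * (LINT x|torus_measure. (cmod (g x - p x))\<^sup>2)"
    using int by simp
  also have "\<dots> < \<delta>"
    using g p by simp
  finally show "\<exists>p. trig_poly p \<and> (LINT x|torus_measure. (cmod (f x - p x))\<^sup>2) < \<delta>"
    using p by blast
qed

text \<open>Dominated convergence turns almost-everywhere limits into mean-square limits. It serves
  three times below: for cutoffs near the boundary, for continuous approximants of a bounded
  function, and for truncations of a general one.\<close>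

lemma trig_closure_dominated:
  fixes f :: "real ^ 's \<Rightarrow> complex"
  assumes u: "\<And>n. u n \<in> trig_closure" and w: "w \<in> L2_torus"
    and f: "f \<in> borel_measurable torus_measure"
    and bound: "\<And>n x. x \<in> torus \<Longrightarrow> cmod (u n x) \<le> cmod (w x)"
      "\<And>x. x \<in> torus \<Longrightarrow> cmod (f x) \<le> cmod (w x)"
    and lim: "AE x in torus_measure. (\<lambda>n. u n x) \<longlonglongrightarrow> f x"
  shows "f \<in> trig_closure"
proof (rule trig_closure_closed)
  note [measurable] = f
  have [measurable]: "u n \<in> borel_measurable torus_measure" for n
    using u by (intro L2_borel trig_closure_L2)
  have "integrable torus_measure (\<lambda>x. (cmod (f x))\<^sup>2)"
    by (rule Bochner_Integration.integrable_bound[OF L2_integrable[OF w]])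
      (use bound in \<open>auto intro!: AE_I2 power_mono\<close>)
  then show "f \<in> L2_torus"
    by (simp add: L2_torus_def)
  have "(\<lambda>n. LINT x|torus_measure. (cmod (f x - u n x))\<^sup>2) \<longlonglongrightarrow> (LINT x|(torus_measure :: (real ^ 's) measure). (0 :: real))"
  proof (rule integral_dominated_convergence[where w = "\<lambda>x. 4 * (cmod (w x))\<^sup>2"])
    show "integrable torus_measure (\<lambda>x. 4 * (cmod (w x))\<^sup>2)"
      using L2_integrable[OF w] by simp
    show "AE x in torus_measure. (\<lambda>n. (cmod (f x - u n x))\<^sup>2) \<longlonglongrightarrow> 0"
      using lim
    proof eventually_elim
      case (elim x)
      have "(\<lambda>n. (cmod (f x - u n x))\<^sup>2) \<longlonglongrightarrow> (cmod (f x - f x))\<^sup>2"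
        by (intro tendsto_intros elim)
      then show ?case by simp
    qed
    show "AE x in torus_measure. norm ((cmod (f x - u n x))\<^sup>2) \<le> 4 * (cmod (w x))\<^sup>2" for n
    proof (rule AE_I2)
      fix x :: "real ^ 's" assume "x \<in> space torus_measure"
      then have "x \<in> torus" by simp
      then have "(cmod (f x))\<^sup>2 \<le> (cmod (w x))\<^sup>2" "(cmod (u n x))\<^sup>2 \<le> (cmod (w x))\<^sup>2"
        using bound by (auto intro!: power_mono)
      then show "norm ((cmod (f x - u n x))\<^sup>2) \<le> 4 * (cmod (w x))\<^sup>2"
        using cmod_diff_square_le[of "f x" "u n x"] unfolding real_norm_def abs_power2 by linarith
    qed
  qed measurable
  then have lim0: "(\<lambda>n. LINT x|torus_measure. (cmod (f x - u n x))\<^sup>2) \<longlonglongrightarrow> 0"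
    by simp
  fix \<delta> :: real assume "\<delta> > 0"
  then have "eventually (\<lambda>n. (LINT x|torus_measure. (cmod (f x - u n x))\<^sup>2) < \<delta>) sequentially"
    using order_tendstoD(2)[OF lim0] by blast
  then show "\<exists>g\<in>trig_closure. (LINT x|torus_measure. (cmod (f x - g x))\<^sup>2) < \<delta>"
    using u by (auto simp: eventually_sequentially)
qed

lemma trig_closure_continuous_zero:
  fixes h :: "real ^ 's \<Rightarrow> complex"
  assumes cont: "continuous_on torus h" and zero: "\<And>x. x \<in> torus - torus_box \<Longrightarrow> h x = 0"
  shows "h \<in> trig_closure"
  unfolding trig_closure_def
proof (intro CollectI conjI allI impI)
  interpret finite_measure "torus_measure :: (real ^ 's) measure" by (rule finite_measure_torus)
  let ?m = "measure torus_measure (torus :: (real ^ 's) set)"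
  show h: "h \<in> L2_torus"
    by (intro L2_continuous cont)
  fix \<delta> :: real assume "\<delta> > 0"
  \<comment> \<open>Chosen so that \<eta> squared times the measure of the cube is below \<delta>;
    the added 1 keeps the denominator positive.\<close>
  define \<eta> where "\<eta> = sqrt (\<delta> / (?m + 1))"
  have m: "?m \<ge> 0" by simp
  have \<eta>: "\<eta> > 0" "\<eta>\<^sup>2 * ?m < \<delta>"
  proof -
    have "\<delta> * ?m < \<delta> * (?m + 1)"
      using \<open>\<delta> > 0\<close> by simp
    then show "\<eta>\<^sup>2 * ?m < \<delta>"
      using \<open>\<delta> > 0\<close> m by (simp add: \<eta>_def divide_less_eq add_nonneg_pos)
    show "\<eta> > 0"
      using \<open>\<delta> > 0\<close> m unfolding \<eta>_def by (intro real_sqrt_gt_zero divide_pos_pos) linarith+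
  qed
  obtain p where p: "trig_poly p" "\<forall>x\<in>torus. cmod (h x - p x) < \<eta>"
    using uniform_trig_approx[OF cont zero \<eta>(1)] by blast
  have "(LINT x|torus_measure. (cmod (h x - p x))\<^sup>2) \<le> (LINT x|(torus_measure :: (real ^ 's) measure). \<eta>\<^sup>2)"
  proof (rule integral_mono)
    show "integrable torus_measure (\<lambda>x. (cmod (h x - p x))\<^sup>2)"
      by (rule L2_diff_integrable[OF h trig_poly_L2[OF p(1)]])
    show "(cmod (h x - p x))\<^sup>2 \<le> \<eta>\<^sup>2" if "x \<in> space torus_measure" for x
      using p(2) that by (intro power_mono) (auto intro: less_imp_le)
  qed simp
  also have "\<dots> = \<eta>\<^sup>2 * ?m"
    by (simp add: mult.commute)
  finally show "\<exists>p. trig_poly p \<and> (LINT x|torus_measure. (cmod (h x - p x))\<^sup>2) < \<delta>"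
    using p(1) \<eta>(2) by (meson le_less_trans)
qed

lemma AE_torus_box: "AE x in torus_measure. x \<in> (torus_box :: (real ^ 's) set)"
proof -
  have "torus - torus_box \<in> null_sets (lebesgue :: (real ^ 's) measure)"
    using negligible_frontier_interval by (auto simp: torus_def torus_box_def negligible_iff_null_sets)
  then have "AE x in lebesgue. (x :: real ^ 's) \<in> torus \<longrightarrow> x \<in> torus_box"
    by (intro AE_I'[of "torus - torus_box"]) auto
  then show ?thesis
    by (subst AE_restrict_space_iff) auto
qed

text \<open>The cutoffs min(1, n d(x)), with d the distance to the complement of the open box, make
  g vanish on the boundary. They equal 1 eventually at each interior point, and the boundary is a
  null set.\<close>

lemma trig_closure_continuous_bounded:
  fixes g :: "real ^ 's \<Rightarrow> complex"
  assumes cont: "continuous_on UNIV g" and bound: "\<And>x. cmod (g x) \<le> M"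
  shows "g \<in> trig_closure"
proof -
  define d :: "real ^ 's \<Rightarrow> real" where "d x = infdist x (- torus_box)" for x
  define c :: "nat \<Rightarrow> real ^ 's \<Rightarrow> complex" where "c n x = complex_of_real (min 1 (real n * d x))" for n x
  have d: "continuous_on A d" for A
    unfolding d_def[abs_def] by (intro continuous_intros)
  have c_le: "cmod (c n x) \<le> 1" for n x
    unfolding c_def norm_of_real by (simp add: d_def infdist_nonneg abs_le_iff min_def)
  have M: "0 \<le> M"
    using order_trans[OF norm_ge_zero bound[of 0]] .
  \<comment> \<open>A corner of the cube witnesses that the complement is nonempty;
    \<open>infdist\<close> to the empty set is 0 by convention.\<close>
  have "(\<chi> j. pi) \<notin> (torus_box :: (real ^ 's) set)"
    by (simp add: torus_box_def mem_box_cart)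
  then have ne: "- torus_box \<noteq> ({} :: (real ^ 's) set)"
    by blast
  have clo: "closed (- torus_box :: (real ^ 's) set)"
    unfolding torus_box_def by (intro closed_Compl open_box)
  have lim: "(\<lambda>n. c n x * g x) \<longlonglongrightarrow> g x" if "x \<in> torus_box" for x
  proof -
    have "d x \<noteq> 0"
      using that in_closed_iff_infdist_zero[OF clo ne] unfolding d_def by blast
    then have pos: "d x > 0"
      using infdist_nonneg[of x "- torus_box"] unfolding d_def by linarith
    obtain N :: nat where N: "1 / d x < real N"
      using reals_Archimedean2 by blast
    have "c n x * g x = g x" if "n \<ge> N" for n
    proof -
      have "1 / d x \<le> real n"
        using N that by linarith
      then have "1 \<le> real n * d x"
        using pos by (simp only: pos_divide_le_eq)
      then show ?thesis
        by (simp add: c_def min_def)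
    qed
    then show ?thesis
      by (intro tendsto_eventually eventually_sequentiallyI)
  qed
  show ?thesis
  proof (rule trig_closure_dominated[where w = "\<lambda>_. complex_of_real M" and u = "\<lambda>n x. c n x * g x"])
    show "(\<lambda>x. c n x * g x) \<in> trig_closure" for n
    proof (rule trig_closure_continuous_zero)
      show "continuous_on torus (\<lambda>x. c n x * g x)"
        unfolding c_def by (intro continuous_intros d continuous_on_subset[OF cont]) auto
      show "c n x * g x = 0" if "x \<in> torus - torus_box" for x
        using that by (simp add: c_def d_def)
    qed
    show "g \<in> borel_measurable torus_measure"
      by (intro continuous_imp_measurable_on_sets_lebesgue continuous_on_subset[OF cont]) auto
    show "cmod (c n x * g x) \<le> cmod (complex_of_real M)" for n x
      using mult_mono[OF c_le[of n x] bound[of x]] M by (simp add: norm_mult)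
    show "cmod (g x) \<le> cmod (complex_of_real M)" for x
      using bound[of x] M by simp
    show "AE x in torus_measure. (\<lambda>n. c n x * g x) \<longlonglongrightarrow> g x"
      using AE_torus_box by eventually_elim (rule lim)
    show "(\<lambda>_. complex_of_real M) \<in> L2_torus"
      by (intro L2_continuous continuous_on_const)
  qed
qed

text \<open>For M > 0 this is the radial projection onto the disc of radius M; \<open>max\<close>
  gives one formula that is continuous also at 0.\<close>

definition truncate_norm :: "real \<Rightarrow> complex \<Rightarrow> complex" where
  "truncate_norm M z = complex_of_real (M / max M (cmod z)) * z"

lemma truncate_norm_le: "M > 0 \<Longrightarrow> cmod (truncate_norm M z) \<le> M"
  by (auto simp: truncate_norm_def norm_mult norm_divide max_def)

lemma truncate_norm_contract: "M > 0 \<Longrightarrow> cmod (truncate_norm M z) \<le> cmod z"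
  by (auto simp: truncate_norm_def norm_mult norm_divide max_def)

lemma truncate_norm_eq: "M > 0 \<Longrightarrow> cmod z \<le> M \<Longrightarrow> truncate_norm M z = z"
  by (simp add: truncate_norm_def max_def)

lemma continuous_truncate_norm: "M > 0 \<Longrightarrow> continuous_on A (truncate_norm M)"
  unfolding truncate_norm_def[abs_def] by (intro continuous_intros) auto

text \<open>A measurable function is an almost-everywhere limit of continuous ones. Truncating these
  at M makes them uniformly bounded and preserves the limit, because f itself is bounded by
  M.\<close>

lemma trig_closure_bounded:
  fixes f :: "real ^ 's \<Rightarrow> complex"
  assumes f: "f \<in> borel_measurable torus_measure" and bound: "\<And>x. cmod (f x) \<le> M" and M: "M > 0"
  shows "f \<in> trig_closure"
proof -
  have "f measurable_on torus"
    using f by (simp add: measurable_on_iff_borel_measurable)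
  then obtain N g where N: "negligible N" and g: "\<And>n. continuous_on UNIV (g n)"
      and lim: "\<And>x. x \<notin> N \<Longrightarrow> (\<lambda>n. g n x) \<longlonglongrightarrow> (if x \<in> torus then f x else 0)"
    unfolding measurable_on_def by blast
  show ?thesis
  proof (rule trig_closure_dominated[where w = "\<lambda>_. complex_of_real M"
        and u = "\<lambda>n x. truncate_norm M (g n x)"])
    show "(\<lambda>x. truncate_norm M (g n x)) \<in> trig_closure" for n
      using M g
      by (intro trig_closure_continuous_bounded[of _ M] truncate_norm_le
          continuous_on_compose2[OF continuous_truncate_norm[of M UNIV]]) auto
    have "AE x in lebesgue. x \<in> torus \<longrightarrow> (\<lambda>n. truncate_norm M (g n x)) \<longlonglongrightarrow> f x"
    proof (rule AE_I')
      show "N \<in> null_sets lebesgue"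
        using N by (simp add: negligible_iff_null_sets)
      have "(\<lambda>n. truncate_norm M (g n x)) \<longlonglongrightarrow> f x" if "x \<in> torus" "x \<notin> N" for x
      proof -
        have "(\<lambda>n. truncate_norm M (g n x)) \<longlonglongrightarrow> truncate_norm M (f x)"
          using lim[OF that(2)] that(1)
          by (intro continuous_on_tendsto_compose[OF continuous_truncate_norm[OF M, of UNIV]]) auto
        then show ?thesis
          using truncate_norm_eq[OF M bound] by simp
      qed
      then show "{x \<in> space lebesgue. \<not> (x \<in> torus \<longrightarrow> (\<lambda>n. truncate_norm M (g n x)) \<longlonglongrightarrow> f x)} \<subseteq> N"
        by auto
    qed
    then show "AE x in torus_measure. (\<lambda>n. truncate_norm M (g n x)) \<longlonglongrightarrow> f x"
      by (subst AE_restrict_space_iff) auto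
  qed (use M f bound truncate_norm_le in \<open>auto intro!: L2_continuous\<close>)
qed

lemma trig_closure_eq_L2: "trig_closure = (L2_torus :: (real ^ 's \<Rightarrow> complex) set)"
proof (intro equalityI subsetI)
  fix f :: "real ^ 's \<Rightarrow> complex" assume f: "f \<in> L2_torus"
  show "f \<in> trig_closure"
  \<comment> \<open>The truncations are dominated by f itself; \<open>Suc n\<close> keeps the radius
    positive.\<close>
  proof (rule trig_closure_dominated[OF _ f, where u = "\<lambda>n x. truncate_norm (real (Suc n)) (f x)"])
    show "(\<lambda>x. truncate_norm (real (Suc n)) (f x)) \<in> trig_closure" for n
      using L2_borel[OF f]
      by (intro trig_closure_bounded[of _ "real (Suc n)"] truncate_norm_le
          borel_measurable_continuous_on[OF continuous_truncate_norm]) auto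
    show "AE x in torus_measure. (\<lambda>n. truncate_norm (real (Suc n)) (f x)) \<longlonglongrightarrow> f x"
    proof (rule AE_I2)
      fix x
      obtain N :: nat where "cmod (f x) < real N"
        using reals_Archimedean2 by blast
      then have "eventually (\<lambda>n. truncate_norm (real (Suc n)) (f x) = f x) sequentially"
        by (intro eventually_sequentiallyI[of N] truncate_norm_eq) auto
      then show "(\<lambda>n. truncate_norm (real (Suc n)) (f x)) \<longlonglongrightarrow> f x"
        by (rule tendsto_eventually)
    qed
  qed (use f in \<open>auto intro: L2_borel truncate_norm_contract\<close>)
qed (rule trig_closure_L2)

section \<open>Parseval's identity and its consequences\<close>

text \<open>The half of Parseval's identity that complements Bessel's inequality.\<close>

lemma parseval_approx:
  fixes f :: "real ^ 's \<Rightarrow> complex"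
  assumes "f \<in> L2_torus" "\<delta> > 0"
  obtains F where "finite F" "(torus_norm f)\<^sup>2 < (\<Sum>k\<in>F. (cmod (fourier_coeff f k))\<^sup>2) + \<delta>"
proof -
  \<comment> \<open>The factor compensates for the normalisation of
    \<open>torus_norm\<close>.\<close>
  have "f \<in> trig_closure" "\<delta> * (2 * pi) ^ CARD('s) > 0"
    using assms by (simp_all add: trig_closure_eq_L2)
  then obtain p where p: "trig_poly p"
      "(LINT x|torus_measure. (cmod (f x - p x))\<^sup>2) < \<delta> * (2 * pi) ^ CARD('s)"
    unfolding trig_closure_def by blast
  then obtain F c where F: "finite F" "p = (\<lambda>x. \<Sum>k\<in>F. c k * torus_char k x)"
    unfolding trig_poly_def by blast
  have "(torus_norm (\<lambda>x. f x - p x))\<^sup>2 < \<delta>"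
    using p(2) by (simp add: torus_norm_square divide_less_eq)
  then have "(torus_norm f)\<^sup>2 - (\<Sum>k\<in>F. (cmod (fourier_coeff f k))\<^sup>2)
        + (\<Sum>k\<in>F. (cmod (fourier_coeff f k - c k))\<^sup>2) < \<delta>"
    unfolding F(2) torus_norm_diff_sum_char[OF F(1) assms(1)] .
  moreover have "(\<Sum>k\<in>F. (cmod (fourier_coeff f k - c k))\<^sup>2) \<ge> 0"
    by (intro sum_nonneg) auto
  ultimately show thesis
    using F(1) by (intro that[of F]) auto
qed

text \<open>Almost all of the norm of f is captured by finitely many coefficients, and Bessel's
  inequality bounds these by the norm of g. The roles are symmetric.\<close>

lemma torus_norm_eqI:
  assumes "f \<in> L2_torus" "g \<in> L2_torus" "fourier_coeff f = fourier_coeff g"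
  shows "torus_norm f = torus_norm g"
proof -
  have le: "(torus_norm f)\<^sup>2 \<le> (torus_norm g)\<^sup>2"
    if L2: "f \<in> L2_torus" "g \<in> L2_torus" and eq: "fourier_coeff f = fourier_coeff g" for f g
  proof (rule field_le_epsilon)
    fix \<delta> :: real assume "\<delta> > 0"
    then obtain F where F: "finite F" "(torus_norm f)\<^sup>2 < (\<Sum>k\<in>F. (cmod (fourier_coeff f k))\<^sup>2) + \<delta>"
      using parseval_approx L2(1) by blast
    then show "(torus_norm f)\<^sup>2 \<le> (torus_norm g)\<^sup>2 + \<delta>"
      using bessel_inequality[OF F(1) L2(2)] eq by simp
  qed
  have "(torus_norm f)\<^sup>2 = (torus_norm g)\<^sup>2"
    using le assms by (intro antisym) auto
  then show ?thesis
    by (simp add: torus_norm_nonneg)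
qed

section \<open>The epsilon-dimension of the Korobov ball\<close>

text \<open>This justifies the \<open>THE\<close> in \<open>korobov_norm\<close>: the weights are
  nonzero, so all admissible g have the same Fourier coefficients and hence the same norm.\<close>

lemma korobov_ball_memD:
  fixes f :: "real ^ 's \<Rightarrow> complex"
  assumes "a > 0" "f \<in> korobov_ball r a"
  obtains g where "g \<in> L2_torus" "korobov_convolution r a g f" "torus_norm g \<le> 1"
proof -
  obtain g where g: "g \<in> L2_torus" "korobov_convolution r a g f"
    using assms by (auto simp: korobov_ball_def korobov_space_def)
  have "korobov_norm r a f = torus_norm g"
    unfolding korobov_norm_def
  proof (rule the_equality)
    fix c assume "\<exists>g\<in>L2_torus. korobov_convolution r a g f \<and> c = torus_norm g"
    then obtain h where h: "h \<in> L2_torus" "korobov_convolution r a h f" "c = torus_norm h"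
      by blast
    have "fourier_coeff h k = fourier_coeff g k" for k
    proof -
      have "korobov_weight a k powr (- r) \<noteq> 0"
        using korobov_weight_pos[OF assms(1), of k] by simp
      then show ?thesis
        using g(2) h(2) unfolding korobov_convolution_def
        by (metis mult_cancel_left of_real_eq_0_iff)
    qed
    then show "c = torus_norm g"
      unfolding h(3) using g h by (intro torus_norm_eqI) auto
  qed (use g in blast)
  then show thesis
    using g assms that by (auto simp: korobov_ball_def)
qed

text \<open>Outside K the multiplier \<open>korobov_weight a k powr (- r)\<close> is at most
  \<epsilon>, so the tail of f is controlled by \<epsilon> times the tail of g.\<close>

lemma korobov_ball_truncation_error:
  fixes f :: "real ^ 's \<Rightarrow> complex"
  assumes "r > 0" "a > 0" "\<epsilon> > 0" and f: "f \<in> korobov_ball r a"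
  defines "K \<equiv> {k :: int ^ 's. korobov_weight a k \<le> \<epsilon> powr (- 1 / r)}"
  shows "torus_norm (\<lambda>x. f x - (\<Sum>k\<in>K. fourier_coeff f k * torus_char k x)) \<le> \<epsilon>"
proof -
  have K: "finite K"
    unfolding K_def using assms by (intro finite_hyperbolic_cross)
  obtain g where g: "g \<in> L2_torus" "korobov_convolution r a g f" "torus_norm g \<le> 1"
    using korobov_ball_memD assms by blast
  have L2: "f \<in> L2_torus"
    using f by (auto simp: korobov_ball_def korobov_space_def)
  have coeff: "(cmod (fourier_coeff f k))\<^sup>2 \<le> \<epsilon>\<^sup>2 * (cmod (fourier_coeff g k))\<^sup>2" if "k \<notin> K" for k
  proof -
    have "korobov_weight a k powr (- r) \<le> (\<epsilon> powr (- 1 / r)) powr (- r)"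
      using that assms by (intro powr_mono2') (auto simp: K_def)
    also have "\<dots> = \<epsilon>"
      using assms by (simp add: powr_powr)
    finally have "cmod (fourier_coeff f k) \<le> \<epsilon> * cmod (fourier_coeff g k)"
      using g(2) by (simp add: korobov_convolution_def norm_mult mult_right_mono)
    then have "(cmod (fourier_coeff f k))\<^sup>2 \<le> (\<epsilon> * cmod (fourier_coeff g k))\<^sup>2"
      by (intro power_mono) auto
    then show ?thesis
      by (simp add: power_mult_distrib)
  qed
  let ?p = "\<lambda>x. f x - (\<Sum>k\<in>K. fourier_coeff f k * torus_char k x)"
  have "(torus_norm ?p)\<^sup>2 \<le> \<epsilon>\<^sup>2"
  proof (rule field_le_epsilon)
    fix \<delta> :: real assume "\<delta> > 0"
    then obtain F where F: "finite F" "(torus_norm f)\<^sup>2 < (\<Sum>k\<in>F. (cmod (fourier_coeff f k))\<^sup>2) + \<delta>"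
      using parseval_approx L2 by blast
    \<comment> \<open>The set F from Parseval need not contain K, so it is enlarged. The part over K
      then cancels against the sum subtracted in \<open>torus_norm_diff_sum_char\<close>.\<close>
    have "(\<Sum>k\<in>F. (cmod (fourier_coeff f k))\<^sup>2) \<le> (\<Sum>k\<in>K \<union> (F - K). (cmod (fourier_coeff f k))\<^sup>2)"
      using F K by (intro sum_mono2) auto
    also have "\<dots> = (\<Sum>k\<in>K. (cmod (fourier_coeff f k))\<^sup>2) + (\<Sum>k\<in>F - K. (cmod (fourier_coeff f k))\<^sup>2)"
      using F K by (intro sum.union_disjoint) auto
    finally have split: "(\<Sum>k\<in>F. (cmod (fourier_coeff f k))\<^sup>2)
        \<le> (\<Sum>k\<in>K. (cmod (fourier_coeff f k))\<^sup>2) + (\<Sum>k\<in>F - K. (cmod (fourier_coeff f k))\<^sup>2)" .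
    have "(\<Sum>k\<in>F - K. (cmod (fourier_coeff f k))\<^sup>2) \<le> \<epsilon>\<^sup>2 * (\<Sum>k\<in>F - K. (cmod (fourier_coeff g k))\<^sup>2)"
      unfolding sum_distrib_left by (intro sum_mono coeff) auto
    also have "\<dots> \<le> \<epsilon>\<^sup>2 * 1"
    proof (intro mult_left_mono)
      have "(\<Sum>k\<in>F - K. (cmod (fourier_coeff g k))\<^sup>2) \<le> (torus_norm g)\<^sup>2"
        using F g by (intro bessel_inequality) auto
      also have "\<dots> \<le> 1"
        using g(3) torus_norm_nonneg by (intro power_le_one)
      finally show "(\<Sum>k\<in>F - K. (cmod (fourier_coeff g k))\<^sup>2) \<le> 1" .
    qed simp
    finally have "(\<Sum>k\<in>F. (cmod (fourier_coeff f k))\<^sup>2)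
        \<le> (\<Sum>k\<in>K. (cmod (fourier_coeff f k))\<^sup>2) + \<epsilon>\<^sup>2"
      using split by simp
    then show "(torus_norm ?p)\<^sup>2 \<le> \<epsilon>\<^sup>2 + \<delta>"
      using torus_norm_diff_sum_char[OF K L2, of "fourier_coeff f"] F by simp
  qed
  then show ?thesis
    using assms by (simp add: torus_norm_nonneg power2_le_iff_abs_le)
qed

text \<open>The witness is the span of the characters with frequencies in K, which contains the
  partial Fourier sum of every f.\<close>

lemma eps_dimension_korobov_le:
  assumes "r > 0" "a > 0" "\<epsilon> > 0"
  defines "K \<equiv> {k :: int ^ 's. korobov_weight a k \<le> \<epsilon> powr (- 1 / r)}"
  shows "eps_dimension fun_scale L2_torus torus_norm \<epsilon>
      (korobov_ball r a :: (real ^ 's \<Rightarrow> complex) set) \<le> enat (card K)"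
proof -
  interpret vector_space "fun_scale :: complex \<Rightarrow> (real ^ 's \<Rightarrow> complex) \<Rightarrow> _"
    by (rule vector_space_fun_scale)
  have K: "finite K"
    unfolding K_def using assms by (intro finite_hyperbolic_cross)
  let ?L = "span (torus_char ` K) :: (real ^ 's \<Rightarrow> complex) set"
  have "subspace (L2_torus :: (real ^ 's \<Rightarrow> complex) set)"
    by (intro subspaceI) (auto simp: fun_scale_def plus_fun_def zero_fun_def
        intro: L2_add L2_scale L2_continuous)
  then have "?L \<subseteq> L2_torus"
    by (intro span_minimal) (auto intro: L2_torus_char)
  then have L: "?L \<in> subspaces_dim_le fun_scale L2_torus (card K)"
    unfolding subspaces_dim_le_def using K by (auto intro!: exI[of _ "torus_char ` K"] card_image_le)
  have "(SUP f\<in>korobov_ball r a. INF g\<in>?L. ereal (torus_norm (f - g))) \<le> ereal \<epsilon>"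
  proof (rule SUP_least)
    fix f :: "real ^ 's \<Rightarrow> complex" assume f: "f \<in> korobov_ball r a"
    let ?p = "\<Sum>k\<in>K. fun_scale (fourier_coeff f k) (torus_char k)"
    have "?p \<in> ?L"
      by (intro span_sum span_scale span_base) auto
    moreover have "f - ?p = (\<lambda>x. f x - (\<Sum>k\<in>K. fourier_coeff f k * torus_char k x))"
    proof -
      have "sum u K x = (\<Sum>k\<in>K. u k x)" for u :: "int ^ 's \<Rightarrow> real ^ 's \<Rightarrow> complex" and x
        using K by (induction K rule: finite_induct) auto
      then show ?thesis
        by (simp add: fun_eq_iff fun_scale_def)
    qed
    then have "ereal (torus_norm (f - ?p)) \<le> ereal \<epsilon>"
      using korobov_ball_truncation_error[OF assms(1-3) f] unfolding K_def by simp
    ultimately show "(INF g\<in>?L. ereal (torus_norm (f - g))) \<le> ereal \<epsilon>"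
      by (rule INF_lower2[where f = "\<lambda>g. ereal (torus_norm (f - g))"])
  qed
  with L show ?thesis
    unfolding eps_dimension_def by (intro INF_lower) blast
qed

theorem theorem4p7:
  fixes r a q \<epsilon> :: real
  assumes "r > 0" and "a > 0"
    and "q \<ge> 2" and "a - 2 / q > 0"
    and "0 < \<epsilon>" and "\<epsilon> \<le> 1"
  shows "ereal_of_enat
           (eps_dimension fun_scale L2_torus torus_norm \<epsilon>
              (korobov_ball r a :: (real ^ 's \<Rightarrow> complex) set))
         \<le> ereal (q * (a - 2 / q) powr (- q * real CARD('s)) * \<epsilon> powr (- (1 + q) / r))"
proof -
  let ?K = "{k :: int ^ 's. korobov_weight a k \<le> \<epsilon> powr (- 1 / r)}"
  have "real (card ?K) \<le> (a - 2 / q) powr (- q * real CARD('s)) * (\<epsilon> powr (- 1 / r)) powr (1 + q)"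
    using assms by (intro card_hyperbolic_cross_le finite_hyperbolic_cross) auto
  also have "\<dots> = (a - 2 / q) powr (- q * real CARD('s)) * \<epsilon> powr (- (1 + q) / r)"
  proof -
    have "- 1 / r * (1 + q) = - (1 + q) / r"
      by (simp add: diff_divide_distrib add_divide_distrib)
    then show ?thesis
      by (simp only: powr_powr)
  qed
  \<comment> \<open>The count gives the estimate without the factor q; inserting it only enlarges
    the right-hand side, as q >= 1.\<close>
  also have "\<dots> \<le> q * ((a - 2 / q) powr (- q * real CARD('s)) * \<epsilon> powr (- (1 + q) / r))"
    using mult_right_mono[of 1 q "(a - 2 / q) powr (- q * real CARD('s)) * \<epsilon> powr (- (1 + q) / r)"] assms
    by simp
  finally have card: "ereal (real (card ?K))
      \<le> ereal (q * (a - 2 / q) powr (- q * real CARD('s)) * \<epsilon> powr (- (1 + q) / r))"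
    by (simp add: mult.assoc)
  have "ereal_of_enat (eps_dimension fun_scale L2_torus torus_norm \<epsilon>
      (korobov_ball r a :: (real ^ 's \<Rightarrow> complex) set)) \<le> ereal_of_enat (enat (card ?K))"
    using eps_dimension_korobov_le assms by (simp only: ereal_of_enat_le_iff)
  also note card[folded ereal_of_enat_simps(1)]
  finally show ?thesis .
qed

end
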